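(* Let $S$ be either the union of the open upper half plane with the rationals of the real line, or the union of the open upper half plane with the irrationals of the real line. Then there exists no $S$-completely universal function $f$.
   Context: Here $d=1$, $U=\{z\in\mathbb{C}:\operatorname{Im}z>0\}$, $T=\mathbb{Q}$ or $T=\mathbb{R}\setminus\mathbb{Q}$, and $S=U\cup T$. Fix an enumeration $(N_j)_{j\ge 0}$ of $\mathbb{N}=\{0,1,2,\dots\}$. For $f$ holomorphic on $U$ and $\zeta\in\overline{U}$ to which all derivatives of $f$ extend continuously, $S_N(f,\zeta)(z)=\sum_{j=0}^N\frac{f^{(N_j)}(\zeta)}{N_j!}(z-\zeta)^{N_j}$ (values of the continuous extensions at boundary points). For $K\subset\mathbb{C}$ compact, $A_D(K)$ is the set of continuous $h:K\to\mathbb{C}$ such that for every open disc $D\subset\mathbb{C}$ and every holomorphic $\phi:D\to\mathbb{C}$ with $\phi(D)\subset K$, $h\circ\phi$ is holomorphic on $D$. $f$ is $S$-bipartite universal if (i) $f$ is holomorphic on $U$ and every derivative $f^{(k)}$, $k\ge0$, is continuously extendable on $S$; (ii) for every compact $L\subseteq S$, every compact $K\subseteq\mathbb{C}\setminus S$ with $\mathbb{C}\setminus K$ connected, and every $h\in A_D(K)$, there exists a sequence $\lambda_n\in\mathbb{N}$ such that $\sup_{z\in K,\zeta\in L}|S_{\lambda_n}(f,\zeta)(z)-h(z)|\to0$ and, for every $k\ge0$, $\sup_{z\in L,\zeta\in L}|(S_{\lambda_n}(f,\zeta))^{(k)}(z)-f^{(k)}(z)|\to0$. $B(f)$ is the set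 of $z\in\partial U=\mathbb{R}$ to which every derivative $f^{(k)}$, $k\ge 0$, can be continuously extended. $U(f,\zeta)$ is the set of $z\in\mathbb{C}$ such that the set of partial sums $\{S_n(f,\zeta)(z):n\ge 0\}$ is dense in $\mathbb{C}$. $f$ is $S$-completely universal if it is $S$-bipartite universal and $B(f)\cap U(f,\zeta)=\varnothing$ for every $\zeta\in S$. *)

theory Defs
  imports "HOL-Complex_Analysis.Complex_Analysis"
begin

definition upper_half_plane :: "complex set" where
  "upper_half_plane = {z. Im z > 0}"

text \<open>Functions on the upper half plane are modelled by total functions; all notions
  below depend only on their values on the upper half plane.\<close>

definition extendable_on :: "(complex \<Rightarrow> complex) \<Rightarrow> complex set \<Rightarrow> bool" where
  "extendable_on h X \<longleftrightarrow>
     (\<exists>g. continuous_on X g \<and> (\<forall>z\<in>upper_half_plane. g z = h z))"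

text \<open>The value at \<open>\<zeta>\<close> of the continuous extension of the \<open>k\<close>-th derivative; it is
  meaningful for \<open>\<zeta>\<close> in the half plane and for boundary points where the extension exists.
  As every boundary point is a limit point of the half plane, the extension is unique
  and its value there is the limit.\<close>
definition deriv_ext :: "(complex \<Rightarrow> complex) \<Rightarrow> nat \<Rightarrow> complex \<Rightarrow> complex" where
  "deriv_ext f k \<zeta> =
     (if \<zeta> \<in> upper_half_plane then (deriv ^^ k) f \<zeta>
      else Lim (at \<zeta> within upper_half_plane) ((deriv ^^ k) f))"

text \<open>\<open>N\<close> is the enumeration of the natural numbers giving the order of summation.\<close>
definition taylor_sum ::
    "(nat \<Rightarrow> nat) \<Rightarrow> (complex \<Rightarrow> complex) \<Rightarrow> complex \<Rightarrow> nat \<Rightarrow> complex \<Rightarrow> complex" where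
  "taylor_sum N f \<zeta> n z = (\<Sum>j\<le>n. deriv_ext f (N j) \<zeta> / fact (N j) * (z - \<zeta>) ^ N j)"

definition A_D :: "complex set \<Rightarrow> (complex \<Rightarrow> complex) set" where
  "A_D K = {h. continuous_on K h \<and>
     (\<forall>c r \<phi>. \<phi> holomorphic_on ball c r \<and> \<phi> ` ball c r \<subseteq> K \<longrightarrow>
        (h \<circ> \<phi>) holomorphic_on ball c r)}"

text \<open>The suprema are taken in \<^typ>\<open>ennreal\<close>, so that a supremum over the empty set is 0
  (\<open>K\<close> and \<open>L\<close> may be empty) and unbounded suprema are infinite.\<close>
definition bipartite_universal ::
    "(nat \<Rightarrow> nat) \<Rightarrow> complex set \<Rightarrow> (complex \<Rightarrow> complex) \<Rightarrow> bool" where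
  "bipartite_universal N S f \<longleftrightarrow>
     f holomorphic_on upper_half_plane \<and>
     (\<forall>k. extendable_on ((deriv ^^ k) f) S) \<and>
     (\<forall>L K h. compact L \<and> L \<subseteq> S \<and> compact K \<and> K \<subseteq> - S \<and> connected (- K) \<and> h \<in> A_D K \<longrightarrow>
        (\<exists>l :: nat \<Rightarrow> nat.
           (\<lambda>n. SUP (z, \<zeta>) \<in> K \<times> L. ennreal (cmod (taylor_sum N f \<zeta> (l n) z - h z)))
             \<longlonglongrightarrow> 0 \<and>
           (\<forall>k. (\<lambda>n. SUP (z, \<zeta>) \<in> L \<times> L.
                   ennreal (cmod ((deriv ^^ k) (taylor_sum N f \<zeta> (l n)) z - deriv_ext f k z)))
             \<longlonglongrightarrow> 0)))"

definition boundary_regular_set :: "(complex \<Rightarrow> complex) \<Rightarrow> complex set" where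
  "boundary_regular_set f =
     {z \<in> frontier upper_half_plane.
        \<forall>k. extendable_on ((deriv ^^ k) f) (insert z upper_half_plane)}"

definition universal_points ::
    "(nat \<Rightarrow> nat) \<Rightarrow> (complex \<Rightarrow> complex) \<Rightarrow> complex \<Rightarrow> complex set" where
  "universal_points N f \<zeta> = {z. closure (range (\<lambda>n. taylor_sum N f \<zeta> n z)) = UNIV}"

definition completely_universal ::
    "(nat \<Rightarrow> nat) \<Rightarrow> complex set \<Rightarrow> (complex \<Rightarrow> complex) \<Rightarrow> bool" where
  "completely_universal N S f \<longleftrightarrow>
     bipartite_universal N S f \<and>
     (\<forall>\<zeta>\<in>S. boundary_regular_set f \<inter> universal_points N f \<zeta> = {})"

end

theory Submission
  imports Defs
begin

text \<open>For any \<open>\<zeta>\<close> in the half plane, universality on singletons \<open>K = {z}\<close> puts every real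
  point outside \<open>T\<close> into the set of universal points of \<open>f\<close> at \<open>\<zeta>\<close>, while every point of \<open>T\<close>
  lies in the boundary regular set of \<open>f\<close>. On the real line both sets are countable
  intersections of open sets, and both \<open>T\<close> and its complement in the line are dense; so the two
  sets meet by the Baire category theorem.\<close>

section \<open>Topology of the half plane and its boundary\<close>

lemma open_upper_half_plane: "open upper_half_plane"
  unfolding upper_half_plane_def by (rule open_halfspace_Im_gt)

lemma closure_upper_half_plane: "closure upper_half_plane = {z. Im z \<ge> 0}"
  using closure_halfspace_gt[of "\<i>" 0]
  by (simp add: upper_half_plane_def inner_complex_def)

lemma frontier_upper_half_plane: "frontier upper_half_plane = \<real>"
  unfolding frontier_def closure_upper_half_plane interior_open[OF open_upper_half_plane]
  by (auto simp: upper_half_plane_def complex_is_Real_iff)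

lemma at_within_upper_half_plane_neq_bot:
  assumes "z \<in> \<real>"
  shows "at z within upper_half_plane \<noteq> bot"
proof -
  have "z \<in> closure upper_half_plane"
    using assms by (simp add: closure_upper_half_plane complex_is_Real_iff)
  moreover have "z \<notin> upper_half_plane"
    using assms by (simp add: upper_half_plane_def complex_is_Real_iff)
  ultimately show ?thesis
    by (simp add: closure_def trivial_limit_within)
qed

section \<open>Oscillation and continuous extension to boundary points\<close>

text \<open>Only values of \<open>h\<close> on \<open>A\<close> count, but the points collected may
  lie outside \<open>A\<close>, as boundary points do. Writing the set as a union of open sets makes
  it open by construction, so letting \<open>e\<close> run through \<open>1 / Suc n\<close> yields a
  countable intersection of open sets.\<close>

definition osc_small :: "('a::metric_space \<Rightarrow> 'b::metric_space) \<Rightarrow> 'a set \<Rightarrow> real \<Rightarrow> 'a set" where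
  "osc_small h A e = \<Union>{V. open V \<and> (\<forall>u\<in>V \<inter> A. \<forall>v\<in>V \<inter> A. dist (h u) (h v) < e)}"

lemma open_osc_small: "open (osc_small h A e)"
  unfolding osc_small_def by (rule open_Union) auto

lemma osc_small_if_continuous_within:
  assumes "continuous (at z within X) g" and "z \<in> X" and "A \<subseteq> X"
    and "\<And>u. u \<in> A \<Longrightarrow> g u = h u" and "e > 0"
  shows "z \<in> osc_small h A e"
proof -
  obtain d where d: "d > 0" "\<And>u. u \<in> X \<Longrightarrow> dist u z < d \<Longrightarrow> dist (g u) (g z) < e / 2"
    using assms(1) \<open>e > 0\<close> unfolding continuous_within_eps_delta by (metis half_gt_zero)
  have "dist (h u) (h v) < e" if "u \<in> ball z d \<inter> A" "v \<in> ball z d \<inter> A" for u v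
  proof -
    have "dist (g u) (g z) < e / 2" "dist (g v) (g z) < e / 2"
      using d(2) that \<open>A \<subseteq> X\<close> by (auto simp: dist_commute)
    then show ?thesis
      using that assms(4) by (metis IntD2 dist_triangle_half_l)
  qed
  then show ?thesis
    unfolding osc_small_def using d(1) by (intro UnionI[of "ball z d"]) auto
qed

text \<open>Arbitrarily small oscillation makes the image under \<open>h\<close> of the filter at
  \<open>z\<close> within \<open>A\<close> a Cauchy filter; it is proper, so completeness provides a
  limit.\<close>

lemma tendsto_if_osc_small:
  fixes h :: "'a::metric_space \<Rightarrow> 'b::complete_space"
  assumes "at z within A \<noteq> bot" and "\<And>n. z \<in> osc_small h A (1 / Suc n)"
  shows "\<exists>l. (h \<longlongrightarrow> l) (at z within A)"
proof -
  have "cauchy_filter (filtermap h (at z within A))"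
    unfolding cauchy_filter_metric_filtermap
  proof (intro allI impI)
    fix e :: real assume "e > 0"
    then obtain n where n: "1 / Suc n < e"
      using nat_approx_posE by blast
    obtain V where V: "open V" "z \<in> V"
      "\<And>u v. u \<in> V \<inter> A \<Longrightarrow> v \<in> V \<inter> A \<Longrightarrow> dist (h u) (h v) < 1 / Suc n"
      using assms(2)[of n] unfolding osc_small_def by blast
    have "eventually (\<lambda>u. u \<in> V \<inter> A) (at z within A)"
      using V by (auto simp: eventually_at_topological)
    with V(3) n show "\<exists>P. eventually P (at z within A) \<and>
        (\<forall>u v. P u \<and> P v \<longrightarrow> dist (h u) (h v) < e)"
      by (intro exI[of _ "\<lambda>u. u \<in> V \<inter> A"]) (metis order.strict_trans)
  qed
  moreover have "filtermap h (at z within A) \<noteq> bot"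
    using assms(1) by (simp add: filtermap_bot_iff)
  ultimately show ?thesis
    using complete_UNIV[where 'a = 'b] unfolding complete_uniform filterlim_def
    by (metis UNIV_I principal_UNIV top_greatest)
qed

lemma osc_small_if_extendable_on:
  assumes "extendable_on h S" and "upper_half_plane \<subseteq> S" and "z \<in> S" and "e > 0"
  shows "z \<in> osc_small h upper_half_plane e"
proof -
  obtain g where "continuous_on S g" "\<forall>u\<in>upper_half_plane. g u = h u"
    using assms(1) unfolding extendable_on_def by blast
  then show ?thesis
    using assms by (intro osc_small_if_continuous_within[of z S g])
      (auto simp: continuous_on_eq_continuous_within)
qed

text \<open>Each derivative has a limit at \<open>z\<close>, and assigning this limit as the value
  at \<open>z\<close> gives the extension. At points of the half plane continuity is unaffected,
  because the half plane is open and does not contain \<open>z\<close>.\<close>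

lemma boundary_regular_setI:
  assumes "f holomorphic_on upper_half_plane" and "z \<in> \<real>"
    and "\<And>k n. z \<in> osc_small ((deriv ^^ k) f) upper_half_plane (1 / Suc n)"
  shows "z \<in> boundary_regular_set f"
proof -
  have z: "z \<notin> upper_half_plane"
    using assms(2) by (auto simp: upper_half_plane_def complex_is_Real_iff)
  have "extendable_on ((deriv ^^ k) f) (insert z upper_half_plane)" for k
  proof -
    let ?h = "(deriv ^^ k) f"
    obtain l where l: "(?h \<longlongrightarrow> l) (at z within upper_half_plane)"
      using tendsto_if_osc_small[OF at_within_upper_half_plane_neq_bot[OF assms(2)] assms(3)]
      by blast
    define g where "g = ?h(z := l)"
    have ev: "continuous (at u within insert z upper_half_plane) g"
      if u: "u \<in> upper_half_plane" for u
    proof -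
      have "continuous_on upper_half_plane ?h"
        by (intro holomorphic_on_imp_continuous_on holomorphic_higher_deriv assms(1)
            open_upper_half_plane)
      then have "continuous_on upper_half_plane g"
        by (rule continuous_on_eq) (use z in \<open>auto simp: g_def\<close>)
      then show ?thesis
        using u open_upper_half_plane continuous_on_eq_continuous_at continuous_at_imp_continuous_at_within
        by blast
    qed
    have "(g \<longlongrightarrow> l) (at z within upper_half_plane)"
      using l by (rule Lim_transform_eventually)
        (use z in \<open>auto simp: g_def eventually_at_filter\<close>)
    moreover have "at z within insert z upper_half_plane = at z within upper_half_plane"
      by (simp add: at_within_def)
    ultimately have "continuous (at z within insert z upper_half_plane) g"
      by (simp add: continuous_within g_def)
    with ev have "continuous_on (insert z upper_half_plane) g"
      by (auto simp: continuous_on_eq_continuous_within)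
    then show ?thesis
      unfolding extendable_on_def using z by (intro exI[of _ g]) (auto simp: g_def)
  qed
  then show ?thesis
    using assms(2) by (simp add: boundary_regular_set_def frontier_upper_half_plane)
qed

section \<open>Density of the partial sums\<close>

text \<open>Applied to a countable basis, this turns density of the partial sums at a point into
  countably many conditions, each of them open in the point.\<close>

lemma closure_range_eq_UNIV_iff:
  fixes s :: "nat \<Rightarrow> 'a::topological_space"
  assumes "topological_basis B"
  shows "closure (range s) = UNIV \<longleftrightarrow> (\<forall>V\<in>B - {{}}. \<exists>n. s n \<in> V)"
proof
  assume dense: "closure (range s) = UNIV"
  show "\<forall>V\<in>B - {{}}. \<exists>n. s n \<in> V"
  proof
    fix V assume "V \<in> B - {{}}"
    then have "V \<inter> range s \<noteq> {}"
      using open_Int_closure_eq_empty[of V "range s"] topological_basis_open[OF assms, of V] dense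
      by simp
    then show "\<exists>n. s n \<in> V"
      by blast
  qed
next
  assume *: "\<forall>V\<in>B - {{}}. \<exists>n. s n \<in> V"
  show "closure (range s) = UNIV"
  proof (intro set_eqI iffI UNIV_I)
    fix w
    show "w \<in> closure (range s)"
      unfolding closure_iff_nhds_not_empty
    proof (intro allI impI)
      fix A W assume "W \<subseteq> A" "open W" "w \<in> W"
      then obtain V where "V \<in> B" "w \<in> V" "V \<subseteq> W"
        using topological_basisE[OF assms] by metis
      then show "range s \<inter> A \<noteq> {}"
        using * \<open>W \<subseteq> A\<close> by blast
    qed
  qed
qed

lemma continuous_on_taylor_sum: "continuous_on X (taylor_sum N f \<zeta> n)"
  unfolding taylor_sum_def by (intro continuous_intros)

text \<open>Bipartite universality with \<open>K = {z}\<close>, \<open>L = {\<zeta>}\<close> and the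
  constant function \<open>w\<close> produces partial sums at \<open>z\<close> converging to
  \<open>w\<close>, for any \<open>w\<close>.\<close>

lemma universal_pointsI:
  assumes "bipartite_universal N S f" and "\<zeta> \<in> S" and "z \<notin> S"
  shows "z \<in> universal_points N f \<zeta>"
proof -
  have "w \<in> closure (range (\<lambda>n. taylor_sum N f \<zeta> n z))" for w
  proof -
    have "connected (- {z})"
      by (rule connected_punctured_universe) simp
    moreover have "(\<lambda>_. w) \<in> A_D {z}"
      by (auto simp: A_D_def o_def)
    ultimately obtain l :: "nat \<Rightarrow> nat" where
      "(\<lambda>n. SUP (z, \<zeta>) \<in> {z} \<times> {\<zeta>}. ennreal (cmod (taylor_sum N f \<zeta> (l n) z - w))) \<longlonglongrightarrow> 0"
      using assms unfolding bipartite_universal_def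
      by (meson compact_sing empty_subsetI insert_subset ComplI)
    \<comment> \<open>The supremum runs over the single pair of \<open>z\<close> and
      \<open>\<zeta>\<close>, so it is just the value there.\<close>
    then have "(\<lambda>n. ennreal (cmod (taylor_sum N f \<zeta> (l n) z - w))) \<longlonglongrightarrow> ennreal 0"
      by simp
    then have "(\<lambda>n. cmod (taylor_sum N f \<zeta> (l n) z - w)) \<longlonglongrightarrow> 0"
      by (subst (asm) tendsto_ennreal_iff) auto
    then have "(\<lambda>n. taylor_sum N f \<zeta> (l n) z) \<longlonglongrightarrow> w"
      using LIM_zero_cancel tendsto_norm_zero_iff by blast
    then show ?thesis
      unfolding closure_sequential by (intro exI[of _ "\<lambda>n. taylor_sum N f \<zeta> (l n) z"]) auto
  qed
  then show ?thesis
    by (auto simp: universal_points_def)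
qed

section \<open>Baire category on the real line and dense subsets of it\<close>

text \<open>The real line is closed in the plane, so Baire's theorem applies to the traces of the
  sets in \<open>\<V>\<close> on it.\<close>

lemma Baire_Reals:
  fixes \<V> :: "complex set set"
  assumes "countable \<V>" and "\<And>V. V \<in> \<V> \<Longrightarrow> open V \<and> \<real> \<subseteq> closure (\<real> \<inter> V)"
  shows "\<exists>z\<in>\<real>. \<forall>V\<in>\<V>. z \<in> V"
proof -
  \<comment> \<open>Inserting \<open>UNIV\<close> adds \<open>\<real>\<close> itself to the family,
    which keeps the intersection inside the line even when \<open>\<V>\<close> is empty.\<close>
  have "\<real> \<subseteq> closure (\<Inter>((\<inter>) \<real> ` insert UNIV \<V>))"
    using assms by (intro Baire) (auto simp: closed_complex_Reals openin_open)
  then have "\<Inter>((\<inter>) \<real> ` insert UNIV \<V>) \<noteq> ({} :: complex set)"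
    by (metis Reals_0 closure_empty empty_iff subset_iff)
  then show ?thesis
    by blast
qed

lemma Reals_subset_closure_of_real_image:
  fixes A :: "real set"
  assumes "closure A = UNIV"
  shows "\<real> \<subseteq> closure (complex_of_real ` A)"
proof -
  have "complex_of_real ` closure A \<subseteq> closure (complex_of_real ` A)"
    by (rule continuous_image_closure_subset[where A = UNIV]) (auto intro: continuous_intros)
  then show ?thesis
    unfolding assms Reals_def .
qed

text \<open>This carries density statements about the real rationals over to the rationals regarded
  as complex numbers.\<close>

lemma of_real_image_Rats: "complex_of_real ` \<rat> = \<rat>"
proof -
  have "complex_of_real (of_rat q) = of_rat q" for q
    by (cases q) (simp add: of_rat_rat)
  then show ?thesis
    by (simp add: Rats_def image_image)
qed

lemma Rats_subset_Reals: "\<rat> \<subseteq> (\<real> :: complex set)"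
  unfolding of_real_image_Rats[symmetric] Reals_def by blast

lemma Reals_subset_closure_Rats: "\<real> \<subseteq> closure (\<rat> :: complex set)"
  using Reals_subset_closure_of_real_image[OF Rats_closure_real]
  unfolding of_real_image_Rats .

text \<open>A ball is uncountable, so a countable set cannot exhaust it.\<close>

lemma closure_Compl_countable:
  fixes A :: "'a::euclidean_space set"
  assumes "countable A"
  shows "closure (- A) = UNIV"
proof (intro set_eqI iffI UNIV_I)
  fix x
  have "\<exists>y\<in>- A. dist y x < e" if "e > 0" for e
    using ball_minus_countable_nonempty[OF assms that, of x] by (auto simp: dist_commute)
  then show "x \<in> closure (- A)"
    unfolding closure_approachable by blast
qed

lemma Reals_subset_closure_irrationals: "\<real> \<subseteq> closure (\<real> - \<rat> :: complex set)"
proof -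
  have "complex_of_real ` (- \<rat>) = \<real> - complex_of_real ` \<rat>"
    by (auto simp: Reals_def)
  then show ?thesis
    using Reals_subset_closure_of_real_image[OF closure_Compl_countable[OF countable_rat]]
    unfolding of_real_image_Rats by simp
qed

theorem corollary4p10:
  fixes N :: "nat \<Rightarrow> nat" and T S :: "complex set"
  assumes "bij N"
    and "T = \<rat> \<or> T = \<real> - \<rat>"
    and "S = upper_half_plane \<union> T"
  shows "\<not> (\<exists>f. completely_universal N S f)"
proof
  assume "\<exists>f. completely_universal N S f"
  then obtain f where f: "bipartite_universal N S f"
    "\<And>\<zeta>. \<zeta> \<in> S \<Longrightarrow> boundary_regular_set f \<inter> universal_points N f \<zeta> = {}"
    unfolding completely_universal_def by blast
  have hol: "f holomorphic_on upper_half_plane"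
    and ext: "\<And>k. extendable_on ((deriv ^^ k) f) S"
    using f(1) unfolding bipartite_universal_def by blast+
  \<comment> \<open>The two choices of \<open>T\<close> are complementary in the line and both
    dense, so these three facts cover both cases and no further case split occurs.\<close>
  have "T \<subseteq> \<real>" "\<real> \<subseteq> closure T" "\<real> \<subseteq> closure (\<real> - T)"
    using assms(2) Rats_subset_Reals Reals_subset_closure_Rats Reals_subset_closure_irrationals
    by (auto simp: double_diff)
  have i: "\<i> \<in> S"
    using assms(3) by (simp add: upper_half_plane_def)
  obtain B :: "complex set set" where B: "countable B" "topological_basis B"
    using ex_countable_basis by blast
  \<comment> \<open>Membership of a real point in all the sets of \<open>R\<close> forces every
    derivative to extend there; the sets \<open>H V\<close> with \<open>V\<close> a nonempty basis
    element intersect exactly in the universal points at \<open>\<i>\<close>.\<close>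
  define R where "R = (\<lambda>(k, n). osc_small ((deriv ^^ k) f) upper_half_plane (1 / Suc n))"
  define H where "H = (\<lambda>V. \<Union>n. taylor_sum N f \<i> n -` V)"
  have univ: "z \<in> universal_points N f \<i> \<longleftrightarrow> (\<forall>V\<in>B - {{}}. z \<in> H V)" for z
    unfolding universal_points_def H_def using closure_range_eq_UNIV_iff[OF B(2)] by auto
  have "open V \<and> \<real> \<subseteq> closure (\<real> \<inter> V)" if "V \<in> range R \<union> H ` (B - {{}})" for V
    using that
  proof
    assume "V \<in> range R"
    then obtain k n where V: "V = osc_small ((deriv ^^ k) f) upper_half_plane (1 / Suc n)"
      by (auto simp: R_def)
    \<comment> \<open>Every derivative extends continuously to \<open>S\<close>, which contains
      \<open>T\<close>, so its oscillation is small near each point of \<open>T\<close>.\<close>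
    have "T \<subseteq> V"
      unfolding V using assms(3)
      by (intro subsetI osc_small_if_extendable_on[OF ext]) auto
    then have "\<real> \<subseteq> closure (\<real> \<inter> V)"
      using \<open>T \<subseteq> \<real>\<close> \<open>\<real> \<subseteq> closure T\<close> closure_mono[of T "\<real> \<inter> V"] by blast
    then show ?thesis
      unfolding V using open_osc_small by blast
  next
    assume "V \<in> H ` (B - {{}})"
    then obtain W where W: "W \<in> B - {{}}" "V = H W"
      by blast
    \<comment> \<open>A real point off \<open>T\<close> is outside \<open>S\<close>, hence
      universal, hence in every \<open>H W\<close>.\<close>
    have "z \<in> V" if "z \<in> \<real> - T" for z
    proof -
      have "z \<notin> S"
        using that assms(3) by (auto simp: upper_half_plane_def complex_is_Real_iff)
      then show ?thesis
        using universal_pointsI[OF f(1) i] univ W by blast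
    qed
    then have "\<real> \<subseteq> closure (\<real> \<inter> V)"
      using \<open>\<real> \<subseteq> closure (\<real> - T)\<close> closure_mono[of "\<real> - T" "\<real> \<inter> V"] by blast
    moreover have "open V"
      using W topological_basis_open[OF B(2)] continuous_on_taylor_sum
      by (auto simp: H_def intro!: open_UN open_vimage)
    ultimately show ?thesis
      by blast
  qed
  moreover have "countable (range R \<union> H ` (B - {{}}))"
    using B(1) by simp
  \<comment> \<open>This common point is both boundary regular and universal for the centre
    \<open>\<i>\<close>, which complete universality forbids.\<close>
  ultimately obtain z where z: "z \<in> \<real>" "\<And>V. V \<in> range R \<union> H ` (B - {{}}) \<Longrightarrow> z \<in> V"
    using Baire_Reals by metis
  have "z \<in> boundary_regular_set f"
    using z by (intro boundary_regular_setI hol) (force simp: R_def)+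
  moreover have "z \<in> universal_points N f \<i>"
    using z(2) univ by blast
  ultimately show False
    using f(2)[OF i] by blast
qed

end
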